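(* Let $E$ and $F$ be real $F^*$-spaces, and suppose there exists a real number $r>0$ such that $$\alpha_F(r)=\inf\left\{\frac{\|2x\|}{\|x\|} : x\in F,\ 0<\|2x\|\leq r\right\}>1.$$ Let $T:E\to F$ be a continuous map with $T(0)=0$ which preserves equality of distance, i.e. there exists a function $\phi:\mathbb{R}_0^+\to\mathbb{R}_0^+$ such that $$\|Tx-Ty\|=\phi(\|x-y\|)\quad\text{for all } x,y\in E,$$ and suppose that $$2T(x)-T(y)\in T(E)\quad\text{for all } x,y\in E.$$ Then $T$ is linear.
   Context: All linear spaces are over $\mathbb{R}$. An $F$-norm on a linear space $E$ is a non-negative function $\|\cdot\|$ on $E$ such that: (i) $\|x\|=0$ iff $x=0$; (ii) $\|ax\|=\|x\|$ for all $x\in E$ and all scalars $a$ with $|a|=1$; (iii) $\|x+y\|\le\|x\|+\|y\|$ for all $x,y\in E$; (iv) for each $x\in E$, $\|a_nx\|\to 0$ whenever the scalars $a_n\to 0$; (v) for each scalar $a$, $\|ax_n\|\to 0$ whenever $\|x_n\|\to 0$. An $F^*$-space is a linear space equipped with an $F$-norm (completeness is not required); it carries the translation-invariant metric $d(x,y)=\|x-y\|$, and continuity is with respect to this metric. $\mathbb{R}_0^+$ denotes the set of non-negative real numbers. The infimum of the empty set is $+\infty$ (this is relevant only if $F=\{0\}$). $T$ is not assumed surjective. *)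

theory Defs
  imports "HOL-Analysis.Analysis"
begin

locale F_norm =
  fixes N :: "'a::real_vector \<Rightarrow> real"
  assumes nonneg: "0 \<le> N x"
    and eq_0_iff: "N x = 0 \<longleftrightarrow> x = 0"
    and scale_unit: "\<bar>a\<bar> = 1 \<Longrightarrow> N (a *\<^sub>R x) = N x"
    and triangle: "N (x + y) \<le> N x + N y"
    and scale_null: "s \<longlonglongrightarrow> 0 \<Longrightarrow> (\<lambda>n. N (s n *\<^sub>R x)) \<longlonglongrightarrow> 0"
    and null_scale: "(\<lambda>n. N (X n)) \<longlonglongrightarrow> 0 \<Longrightarrow> (\<lambda>n. N (a *\<^sub>R X n)) \<longlonglongrightarrow> 0"

definition F_dist :: "('a::real_vector \<Rightarrow> real) \<Rightarrow> 'a \<Rightarrow> 'a \<Rightarrow> real"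
  where "F_dist N x y = N (x - y)"

lemma (in F_norm) Metric_space_F_dist: "Metric_space UNIV (F_dist N)"
proof
  fix x y z :: 'a
  show "0 \<le> F_dist N x y"
    by (simp add: F_dist_def nonneg)
  show "F_dist N x y = F_dist N y x"
    using scale_unit[of "-1" "x - y"] by (simp add: F_dist_def)
  show "F_dist N x y = 0 \<longleftrightarrow> x = y"
    by (simp add: F_dist_def eq_0_iff)
  show "F_dist N x z \<le> F_dist N x y + F_dist N y z"
    using triangle[of "x - y" "y - z"] by (simp add: F_dist_def)
qed

definition F_topology :: "('a::real_vector \<Rightarrow> real) \<Rightarrow> 'a topology"
  where "F_topology N = Metric_space.mtopology UNIV (F_dist N)"

text \<open>The infimum is taken in the extended reals, so that it is \<open>\<infinity>\<close> for the zero space.\<close>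

definition F_alpha :: "('a::real_vector \<Rightarrow> real) \<Rightarrow> real \<Rightarrow> ereal"
  where "F_alpha N r =
    (INF x\<in>{x. 0 < N (2 *\<^sub>R x) \<and> N (2 *\<^sub>R x) \<le> r}. ereal (N (2 *\<^sub>R x) / N x))"

text \<open>The function \<open>\<phi>\<close> maps the non-negative reals to themselves; its values at negative
  arguments are irrelevant.\<close>

definition preserves_equality_of_distance ::
    "('a::real_vector \<Rightarrow> real) \<Rightarrow> ('b::real_vector \<Rightarrow> real) \<Rightarrow> ('a \<Rightarrow> 'b) \<Rightarrow> bool"
  where "preserves_equality_of_distance N M T \<longleftrightarrow>
    (\<exists>\<phi> :: real \<Rightarrow> real. (\<forall>t\<ge>0. 0 \<le> \<phi> t) \<and> (\<forall>x y. M (T x - T y) = \<phi> (N (x - y))))"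

end

theory Submission
  imports Defs
begin

text \<open>
  Fix \<open>c\<close> and \<open>x\<close> and choose \<open>y\<close> with \<open>T y = 2 T c - T (c + x)\<close>. The reflection
  \<open>z \<mapsto> c + x + y - z\<close> of \<open>E\<close> descends to an isometry of the range of \<open>T\<close>, because \<open>\<phi>\<close> is a
  function of the distance, and this isometry swaps \<open>T (c + x)\<close> and \<open>T y\<close>. If \<open>x\<close> is small,
  Vogt's fixed point argument, applied to the points of the range having the same distance
  to \<open>T (c + x)\<close> and to \<open>T y\<close> as \<open>T c\<close> has, shows that it fixes \<open>T c\<close>. Hence
  \<open>T (x + y) = T c\<close>, so \<open>\<phi>\<close> vanishes at \<open>\<parallel>x + y - c\<parallel>\<close>, the vector \<open>x + y - c\<close> is a period of \<open>T\<close>,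
  and \<open>T (c - x) = T y = 2 T c - T (c + x)\<close>. Subdividing segments removes the smallness
  assumption, and Jensen's equation together with continuity gives linearity.
\<close>

section \<open>Displacements under isometries of a bounded metric space\<close>

text \<open>For an isometry \<open>g\<close>, the isometry \<open>V \<circ> g\<inverse> \<circ> V \<circ> g\<close> moves \<open>m\<close> at least \<open>K\<close> times as far as
  \<open>g\<close> does; so the supremum of the displacements of \<open>m\<close> is zero.\<close>

lemma (in Metric_space) Vogt_fixed_point:
  assumes m: "m \<in> M" and bounded: "\<And>x. x \<in> M \<Longrightarrow> d m x \<le> B"
    and V: "bij_betw V M M" "\<And>x y. x \<in> M \<Longrightarrow> y \<in> M \<Longrightarrow> d (V x) (V y) = d x y" "V m = m"
    and K: "1 < K" "\<And>x. x \<in> M \<Longrightarrow> K * d m x \<le> d (V x) x"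
    and g: "bij_betw g M M" "\<And>x y. x \<in> M \<Longrightarrow> y \<in> M \<Longrightarrow> d (g x) (g y) = d x y"
  shows "g m = m"
proof -
  define I where "I = {h. bij_betw h M M \<and> (\<forall>x\<in>M. \<forall>y\<in>M. d (h x) (h y) = d x y)}"
  define S where "S = (SUP h\<in>I. d m (h m))"
  have gI: "g \<in> I"
    using g by (simp add: I_def)
  have in_M: "h x \<in> M" if "h \<in> I" "x \<in> M" for h x
    using that by (auto simp: I_def dest: bij_betwE)
  have bdd: "bdd_above ((\<lambda>h. d m (h m)) ` I)"
    using bounded in_M m by (intro bdd_aboveI2[of _ _ B]) auto
  have step: "K * d m (h m) \<le> S" if h: "h \<in> I" for h
  proof -
    define k where "k = inv_into M h"
    have hb: "bij_betw h M M" and hd: "\<And>x y. x \<in> M \<Longrightarrow> y \<in> M \<Longrightarrow> d (h x) (h y) = d x y"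
      using h by (auto simp: I_def)
    have kb: "bij_betw k M M"
      unfolding k_def by (rule bij_betw_inv_into[OF hb])
    have hk: "h (k x) = x" "k x \<in> M" if "x \<in> M" for x
      using that hb kb bij_betwE bij_betw_inv_into_right k_def by fastforce+
    have kd: "d (k x) (k y) = d x y" if "x \<in> M" "y \<in> M" for x y
      using hd[of "k x" "k y"] hk that by simp
    have VM: "V x \<in> M" if "x \<in> M" for x
      using V(1) that by (auto dest: bij_betwE)
    define h' where "h' = V \<circ> k \<circ> V \<circ> h"
    have "bij_betw h' M M"
      unfolding h'_def using V(1) hb kb by (intro bij_betw_trans)
    then have "h' \<in> I"
      using V(2) hd kd VM hk in_M[OF h] by (simp add: I_def h'_def)
    then have "d m (h' m) \<le> S"
      unfolding S_def using bdd by (rule cSUP_upper)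
    \<comment> \<open>As \<open>V\<close> fixes \<open>m\<close>, the outer \<open>V\<close> can be
      stripped from both points; applying \<open>h\<close> to both then cancels
      \<open>k\<close>.\<close>
    moreover have "d m (h' m) = d (V (h m)) (h m)"
    proof -
      have "d m (h' m) = d (V m) (V (k (V (h m))))"
        by (simp add: h'_def V)
      also have "\<dots> = d (h m) (h (k (V (h m))))"
        using V(2)[of m "k (V (h m))"] hd[of m "k (V (h m))"] hk VM in_M[OF h m] m by simp
      also have "\<dots> = d (V (h m)) (h m)"
        using hk VM in_M h m by (simp add: commute)
      finally show ?thesis .
    qed
    ultimately show ?thesis
      using K(2)[of "h m"] in_M[OF h m] by simp
  qed
  have "d m (h m) \<le> S / K" if "h \<in> I" for h
    using step[OF that] K(1) by (simp add: field_simps)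
  then have "S \<le> S / K"
    unfolding S_def[symmetric] using gI by (subst S_def, intro cSUP_least) auto
  then have "S * (K - 1) \<le> 0"
    using K(1) by (simp add: field_simps)
  then have "S \<le> 0"
    using K(1) by (simp add: mult_le_0_iff)
  then have "K * d m (g m) \<le> 0"
    using step[OF gI] by simp
  then have "d m (g m) = 0"
    using K(1) nonneg[of m "g m"] by (simp add: mult_le_0_iff)
  then show ?thesis
    using zero m in_M[OF gI m] by simp
qed

section \<open>F-norm estimates and pointwise continuity\<close>

context F_norm
begin

lemma minus: "N (- x) = N x"
  using scale_unit[of "-1" x] by simp

lemma minus_commute: "N (x - y) = N (y - x)"
  using minus[of "x - y"] by simp

lemma diff_triangle: "N (x - z) \<le> N (x - y) + N (y - z)"
  using triangle[of "x - y" "y - z"] by simp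

lemma double_le: "N (2 *\<^sub>R x) \<le> 2 * N x"
  using triangle[of x x] by (simp add: scaleR_2)

lemma scale_tendsto:
  assumes "s \<longlonglongrightarrow> a"
  shows "(\<lambda>n. N (s n *\<^sub>R x - a *\<^sub>R x)) \<longlonglongrightarrow> 0"
  using scale_null[OF LIM_zero[OF assms], of x] by (simp add: scaleR_diff_left)

text \<open>The infimum may be infinite, so a real \<open>K\<close> strictly between 1 and it is
  chosen; at \<open>x = 0\<close> both sides vanish.\<close>

lemma F_alpha_double_ge:
  assumes "1 < F_alpha N r"
  obtains K where "1 < K" "\<And>x. N (2 *\<^sub>R x) \<le> r \<Longrightarrow> K * N x \<le> N (2 *\<^sub>R x)"
proof -
  obtain K where K: "1 < ereal K" "ereal K < F_alpha N r"
    using ereal_dense2[OF assms] by blast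
  have "K * N x \<le> N (2 *\<^sub>R x)" if "N (2 *\<^sub>R x) \<le> r" for x
  proof (cases "x = 0")
    case False
    then have pos: "0 < N x" "0 < N (2 *\<^sub>R x)"
      using nonneg[of x] nonneg[of "2 *\<^sub>R x"] eq_0_iff[of x] eq_0_iff[of "2 *\<^sub>R x"] by auto
    then have "F_alpha N r \<le> ereal (N (2 *\<^sub>R x) / N x)"
      unfolding F_alpha_def using that by (intro INF_lower) simp
    then have "K \<le> N (2 *\<^sub>R x) / N x"
      using K(2) by (metis ereal_less_eq(3) less_le_trans less_imp_le)
    then show ?thesis
      using pos by (simp add: field_simps)
  qed (use eq_0_iff[of 0] in simp)
  then show ?thesis
    using K(1) that by simp
qed

end

lemma F_continuous_at:
  assumes "F_norm N" "F_norm L" "continuous_map (F_topology N) (F_topology L) f" "0 < e"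
  obtains \<delta> where "0 < \<delta>" "\<And>y. N (x - y) < \<delta> \<Longrightarrow> L (f x - f y) < e"
proof -
  interpret Metric_space12 UNIV "F_dist N" UNIV "F_dist L"
    using assms by (simp add: Metric_space12_def F_norm.Metric_space_F_dist)
  show ?thesis
    using assms(3,4) that unfolding F_topology_def M1.metric_continuous_map[OF M2.Metric_space_axioms] F_dist_def
    by (metis UNIV_I)
qed

section \<open>Jensen's equation for small displacements\<close>

locale equal_distance_map = E: F_norm N + F: F_norm L
  for N :: "'e::real_vector \<Rightarrow> real" and L :: "'f::real_vector \<Rightarrow> real" +
  fixes T :: "'e \<Rightarrow> 'f" and \<phi> :: "real \<Rightarrow> real"
  assumes dist_T: "L (T x - T y) = \<phi> (N (x - y))"
    and reflection_closed: "2 *\<^sub>R T x - T y \<in> range T"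
begin

text \<open>Equal images force \<phi> to vanish at \<open>N (x - y)\<close>, hence at
  \<open>N (z - w)\<close>. This lets reflections of the domain descend to the range and turns one
  coincidence of values into a period.\<close>

lemma periodic:
  assumes "T x = T y" "N (x - y) = N (z - w)"
  shows "T z = T w"
  using assms dist_T[of x y] dist_T[of z w] F.eq_0_iff[of 0] F.eq_0_iff[of "T z - T w"] by simp

lemma Jensen_small:
  assumes "1 < F_alpha L r" and small: "4 * L (T (c + x) - T c) \<le> r"
  shows "T (c + x) + T (c - x) = 2 *\<^sub>R T c"
proof -
  obtain K where K: "1 < K" "\<And>u. L (2 *\<^sub>R u) \<le> r \<Longrightarrow> K * L u \<le> L (2 *\<^sub>R u)"
    using F.F_alpha_double_ge[OF assms(1)] by blast
  obtain y where y: "T y = 2 *\<^sub>R T c - T (c + x)"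
    using reflection_closed[of c "c + x"] by (metis imageE)
  define \<rho> where "\<rho> = L (T (c + x) - T c)"
  \<comment> \<open>The two centres \<open>T (c + x)\<close> and \<open>T y\<close> enter
    symmetrically, so any isometry of the range that swaps them preserves \<open>A\<close>; both
    \<open>V\<close> and \<open>g\<close> do.\<close>
  define A where "A = {u \<in> range T. L (u - T (c + x)) = \<rho> \<and> L (u - T y) = \<rho>}"
  define V where "V u = 2 *\<^sub>R T c - u" for u
  \<comment> \<open>\<open>inv T\<close> picks an arbitrary preimage; two preimages of one point
    have reflections with equal images, by \<open>periodic\<close>.\<close>
  define g where "g u = T (c + x + y - inv T u)" for u
  have gT: "g (T z) = T (c + x + y - z)" for z
  proof -
    have "T (inv T (T z)) = T z"
      by (simp add: f_inv_into_f)
    moreover have "N (inv T (T z) - z) = N ((c + x + y - inv T (T z)) - (c + x + y - z))"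
      using E.minus_commute by simp
    ultimately show ?thesis
      unfolding g_def by (rule periodic)
  qed
  have g_dist: "L (g u - g v) = L (u - v)" if "u \<in> range T" "v \<in> range T" for u v
    using that E.minus_commute by (auto simp: gT dist_T)
  have g_range: "g u \<in> range T" and g_g: "g (g u) = u" if "u \<in> range T" for u
    using that by (auto simp: gT)
  have g_swap: "g (T (c + x)) = T y" "g (T y) = T (c + x)"
    by (simp_all add: gT)
  have gA: "g u \<in> A" if "u \<in> A" for u
    using that g_dist[of u "T y"] g_dist[of u "T (c + x)"] g_range
    by (auto simp: A_def g_swap)
  have V_V: "V (V u) = u" for u
    by (simp add: V_def)
  have V_dist: "L (V u - V v) = L (u - v)" for u v
    using F.minus_commute by (simp add: V_def)
  have V_swap: "V (T (c + x)) = T y" "V (T y) = T (c + x)"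
    by (simp_all add: V_def y)
  have VA: "V u \<in> A" if "u \<in> A" for u
    using that V_dist[of u "T y"] V_dist[of u "T (c + x)"] reflection_closed
    by (auto simp: A_def V_swap) (auto simp: V_def)
  have cA: "T c \<in> A"
    unfolding A_def \<rho>_def using F.minus_commute by (auto simp: y scaleR_2)
  have A_bound: "L (T c - u) \<le> 2 * \<rho>" if "u \<in> A" for u
    using that F.diff_triangle[of "T c" u "T (c + x)"] F.minus_commute
    by (auto simp: A_def \<rho>_def)
  have expand: "K * L (T c - u) \<le> L (V u - u)" if "u \<in> A" for u
  proof -
    have eq: "V u - u = 2 *\<^sub>R (T c - u)"
      by (simp add: V_def scaleR_2)
    \<comment> \<open>Points of \<open>A\<close> lie within \<open>2 * \<rho>\<close> of
      \<open>T c\<close>, and doubling at most doubles the F-norm: hence the factor 4 in the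
      smallness hypothesis.\<close>
    have "L (2 *\<^sub>R (T c - u)) \<le> r"
      using F.double_le[of "T c - u"] A_bound[OF that] small by (simp add: \<rho>_def)
    then show ?thesis
      using K(2) eq by simp
  qed
  interpret A: Metric_space A "F_dist L"
    using Metric_space.subspace[OF F.Metric_space_F_dist] by simp
  have "g (T c) = T c"
  proof (rule A.Vogt_fixed_point[where V = V and K = K and B = "2 * \<rho>"])
    show "bij_betw V A A"
      using VA V_V by (intro bij_betw_byWitness[where f' = V]) auto
    show "bij_betw g A A"
      using gA g_g by (intro bij_betw_byWitness[where f' = g]) (auto simp: A_def)
    show "V (T c) = T c"
      by (simp add: V_def scaleR_2)
    show "F_dist L (g u) (g v) = F_dist L u v" if "u \<in> A" "v \<in> A" for u v
      using that g_dist by (simp add: F_dist_def A_def)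
  qed (use cA A_bound V_dist K(1) expand in \<open>simp_all add: F_dist_def\<close>)
  then have "T (x + y) = T c"
    by (simp add: gT algebra_simps)
  \<comment> \<open>Both pairs have the same difference, \<open>x + y - c\<close>.\<close>
  then have "T y = T (c - x)"
    by (rule periodic) (simp add: algebra_simps)
  then show ?thesis
    using y by (metis add.commute diff_add_cancel)
qed

end

section \<open>From the local Jensen equation to linearity\<close>

text \<open>Vanishing second differences make the first differences constant, in both directions
  from 0.\<close>

lemma arithmetic_progression:
  fixes f :: "int \<Rightarrow> 'a::real_vector"
  assumes "\<And>k. f (k + 1) + f (k - 1) = 2 *\<^sub>R f k"
  shows "f k = f 0 + of_int k *\<^sub>R (f 1 - f 0)"
proof -
  define D where "D k = f (k + 1) - f k" for k
  have step: "D k = D (k - 1)" for k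
    using assms[of k] by (simp add: D_def scaleR_2 algebra_simps)
  have D: "D k = D 0" for k
  proof (induction k rule: int_induct[where k = 0])
    case (step1 i)
    then show ?case using step[of "i + 1"] by simp
  next
    case (step2 i)
    then show ?case using step[of i] by simp
  qed simp
  show ?thesis
  proof (induction k rule: int_induct[where k = 0])
    case (step1 i)
    have "f (i + 1) = f i + (f 1 - f 0)"
      using D[of i] by (simp add: D_def algebra_simps)
    with step1 show ?case by (simp add: scaleR_add_left)
  next
    case (step2 i)
    have "f (i - 1) = f i - (f 1 - f 0)"
      using D[of "i - 1"] by (simp add: D_def algebra_simps)
    with step2 show ?case by (simp add: scaleR_diff_left)
  qed simp
qed

text \<open>Along a grid on the line through \<open>c\<close> with a small enough step
  \<open>x / (n + 1)\<close>, the local equation makes the values of \<open>T\<close> an arithmetic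
  progression, which is symmetric about its term at \<open>c\<close>.\<close>

lemma Jensen_local_to_global:
  fixes T :: "'a::real_vector \<Rightarrow> 'b::real_vector"
  assumes "F_norm N" and "0 < \<delta>"
    and local: "\<And>c x. N x < \<delta> \<Longrightarrow> T (c + x) + T (c - x) = 2 *\<^sub>R T c"
  shows "T (c + x) + T (c - x) = 2 *\<^sub>R T c"
proof -
  interpret F_norm N by fact
  have "(\<lambda>n. N (inverse (real (Suc n)) *\<^sub>R x)) \<longlonglongrightarrow> 0"
    by (rule scale_null[OF LIMSEQ_inverse_real_of_nat])
  then have "\<forall>\<^sub>F n in sequentially. N (inverse (real (Suc n)) *\<^sub>R x) < \<delta>"
    using \<open>0 < \<delta>\<close> by (rule order_tendstoD)
  then obtain n where n: "N (inverse (real (Suc n)) *\<^sub>R x) < \<delta>"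
    by (meson eventually_happens' sequentially_bot)
  define h where "h = inverse (real (Suc n)) *\<^sub>R x"
  define f where "f k = T (c + of_int k *\<^sub>R h)" for k :: int
  have "f (k + 1) + f (k - 1) = 2 *\<^sub>R f k" for k
    using local[of h "c + of_int k *\<^sub>R h"] n[folded h_def] by (simp add: f_def algebra_simps)
  then have f: "f k = f 0 + of_int k *\<^sub>R (f 1 - f 0)" for k
    by (rule arithmetic_progression)
  have "real (Suc n) *\<^sub>R h = x"
    by (simp add: h_def)
  then have "f (int (Suc n)) = T (c + x)" "f (- int (Suc n)) = T (c - x)" "f 0 = T c"
    unfolding f_def by (simp_all del: of_nat_Suc)
  moreover have "f k + f (- k) = 2 *\<^sub>R f 0" for k
    by (subst (1 2) f) (simp add: scaleR_2)
  ultimately show ?thesis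
    by metis
qed

lemma Jensen_imp_additive:
  fixes T :: "'a::real_vector \<Rightarrow> 'b::real_vector"
  assumes Jensen: "\<And>c x. T (c + x) + T (c - x) = 2 *\<^sub>R T c" and "T 0 = 0"
  shows "T (x + y) = T x + T y"
proof -
  \<comment> \<open>Reflecting \<open>2 *\<^sub>R z\<close> in \<open>z\<close> gives 0, where
    \<open>T\<close> vanishes.\<close>
  have double: "T (2 *\<^sub>R z) = 2 *\<^sub>R T z" for z
    using Jensen[of z z] \<open>T 0 = 0\<close> by (simp add: scaleR_2)
  \<comment> \<open>\<open>x\<close> and \<open>y\<close> are mirror images in their midpoint
    \<open>c\<close>.\<close>
  define c where "c = (1/2) *\<^sub>R (x + y)"
  define d where "d = (1/2) *\<^sub>R (x - y)"
  have "c + d = x" "c - d = y" "2 *\<^sub>R c = x + y"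
    by (simp_all add: c_def d_def scaleR_add_right[symmetric] scaleR_diff_right[symmetric]
        scaleR_2[symmetric])
  then show ?thesis
    using Jensen[of c d] double[of c] by simp
qed

text \<open>Additivity gives homogeneity for rational scalars; continuity extends it to their real
  limits.\<close>

lemma additive_F_continuous_imp_linear:
  fixes T :: "'a::real_vector \<Rightarrow> 'b::real_vector"
  assumes "F_norm N" "F_norm L" "continuous_map (F_topology N) (F_topology L) T"
    and add: "\<And>x y. T (x + y) = T x + T y"
  shows "linear T"
proof (rule linearI)
  interpret N: F_norm N by fact
  interpret L: F_norm L by fact
  interpret additive T by standard (rule add)
  have nat: "T (real n *\<^sub>R x) = real n *\<^sub>R T x" for n x
    by (induction n) (simp_all add: zero add scaleR_add_left)
  have int: "T (of_int k *\<^sub>R x) = of_int k *\<^sub>R T x" for k x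
    by (cases k rule: int_cases2) (simp_all add: nat minus)
  fix a :: real and x
  define q where "q n = of_int \<lfloor>real (Suc n) * a\<rfloor> / real (Suc n)" for n
  have Tq: "T (q n *\<^sub>R x) = q n *\<^sub>R T x" for n
  proof -
    have "real (Suc n) *\<^sub>R T (q n *\<^sub>R x) = T (of_int \<lfloor>real (Suc n) * a\<rfloor> *\<^sub>R x)"
      unfolding nat[symmetric] by (simp add: q_def del: of_nat_Suc)
    also have "\<dots> = real (Suc n) *\<^sub>R (q n *\<^sub>R T x)"
      unfolding int by (simp add: q_def del: of_nat_Suc)
    finally show ?thesis
      by (simp only: scaleR_cancel_left of_nat_eq_0_iff) simp
  qed
  have "q \<longlonglongrightarrow> a"
  proof (rule LIM_zero_cancel, rule Lim_null_comparison)
    show "\<forall>\<^sub>F n in sequentially. norm (q n - a) \<le> inverse (real (Suc n))"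
    proof (intro always_eventually allI)
      fix n
      have "\<bar>of_int \<lfloor>real (Suc n) * a\<rfloor> - real (Suc n) * a\<bar> \<le> 1"
        by linarith
      moreover have "q n - a = (of_int \<lfloor>real (Suc n) * a\<rfloor> - real (Suc n) * a) / real (Suc n)"
        by (simp add: q_def diff_divide_distrib del: of_nat_Suc)
      ultimately show "norm (q n - a) \<le> inverse (real (Suc n))"
        by (simp add: abs_divide inverse_eq_divide divide_right_mono del: of_nat_Suc)
    qed
    show "(\<lambda>n. inverse (real (Suc n))) \<longlonglongrightarrow> 0"
      by (rule LIMSEQ_inverse_real_of_nat)
  qed
  have "(\<lambda>n. L (T (a *\<^sub>R x) - T (q n *\<^sub>R x))) \<longlonglongrightarrow> 0"
  proof (rule order_tendstoI)
    fix e :: real assume "0 < e"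
    then obtain \<delta> where \<delta>: "0 < \<delta>" "\<And>y. N (a *\<^sub>R x - y) < \<delta> \<Longrightarrow> L (T (a *\<^sub>R x) - T y) < e"
      using F_continuous_at[OF assms(1-3)] by blast
    have "\<forall>\<^sub>F n in sequentially. N (q n *\<^sub>R x - a *\<^sub>R x) < \<delta>"
      using N.scale_tendsto[OF \<open>q \<longlonglongrightarrow> a\<close>] \<delta>(1) by (rule order_tendstoD)
    then show "\<forall>\<^sub>F n in sequentially. L (T (a *\<^sub>R x) - T (q n *\<^sub>R x)) < e"
      by eventually_elim (metis \<delta>(2) N.minus_commute)
  next
    fix e :: real assume "e < 0"
    then show "\<forall>\<^sub>F n in sequentially. e < L (T (a *\<^sub>R x) - T (q n *\<^sub>R x))"
      by (intro always_eventually allI less_le_trans[OF _ L.nonneg])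
  qed
  \<comment> \<open>A constant is bounded by a null sequence: \<open>T (q n *\<^sub>R x)\<close>
    equals \<open>q n *\<^sub>R T x\<close>, and its distances to \<open>T (a *\<^sub>R x)\<close>
    and to \<open>a *\<^sub>R T x\<close> both tend to 0.\<close>
  from tendsto_add[OF this L.scale_tendsto[OF \<open>q \<longlonglongrightarrow> a\<close>, of "T x"]]
  have "(\<lambda>n. L (T (a *\<^sub>R x) - q n *\<^sub>R T x) + L (q n *\<^sub>R T x - a *\<^sub>R T x)) \<longlonglongrightarrow> 0"
    by (simp add: Tq)
  then have "L (T (a *\<^sub>R x) - a *\<^sub>R T x) \<le> 0"
    by (rule LIMSEQ_le_const) (use L.diff_triangle in blast)
  then show "T (a *\<^sub>R x) = a *\<^sub>R T x"
    using L.nonneg[of "T (a *\<^sub>R x) - a *\<^sub>R T x"] L.eq_0_iff[of "T (a *\<^sub>R x) - a *\<^sub>R T x"] by simp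
qed (rule add)

theorem theorem2p2:
  fixes N\<^sub>E :: "'e::real_vector \<Rightarrow> real" and N\<^sub>F :: "'f::real_vector \<Rightarrow> real"
    and T :: "'e \<Rightarrow> 'f"
  assumes "F_norm N\<^sub>E" and "F_norm N\<^sub>F"
    and "\<exists>r>0. F_alpha N\<^sub>F r > 1"
    and "continuous_map (F_topology N\<^sub>E) (F_topology N\<^sub>F) T"
    and "T 0 = 0"
    and "preserves_equality_of_distance N\<^sub>E N\<^sub>F T"
    and "\<And>x y. 2 *\<^sub>R T x - T y \<in> range T"
  shows "linear T"
proof -
  obtain r where r: "0 < r" "1 < F_alpha N\<^sub>F r"
    using assms(3) by blast
  obtain \<phi> where \<phi>: "\<And>x y. N\<^sub>F (T x - T y) = \<phi> (N\<^sub>E (x - y))"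
    using assms(6) unfolding preserves_equality_of_distance_def by blast
  interpret equal_distance_map N\<^sub>E N\<^sub>F T \<phi>
    using assms(1,2,7) \<phi> by (simp add: equal_distance_map_def equal_distance_map_axioms_def)
  obtain \<delta> where \<delta>: "0 < \<delta>" "\<And>y. N\<^sub>E (0 - y) < \<delta> \<Longrightarrow> N\<^sub>F (T 0 - T y) < r / 4"
    using F_continuous_at[OF assms(1,2,4), of "r / 4" 0] r(1) by auto
  \<comment> \<open>The \<delta> found at 0 serves every \<open>c\<close>, because the distance from
    \<open>T (c + x)\<close> to \<open>T c\<close> depends only on the F-norm of
    \<open>x\<close>.\<close>
  have "T (c + x) + T (c - x) = 2 *\<^sub>R T c" if "N\<^sub>E x < \<delta>" for c x
  proof (rule Jensen_small[OF r(2)])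
    have "N\<^sub>F (T (c + x) - T c) = N\<^sub>F (T 0 - T x)"
      using E.minus_commute[of 0 x] by (simp add: \<phi>)
    also have "\<dots> < r / 4"
      using \<delta>(2)[of x] that E.minus by simp
    finally show "4 * N\<^sub>F (T (c + x) - T c) \<le> r"
      by simp
  qed
  then have "T (c + x) + T (c - x) = 2 *\<^sub>R T c" for c x
    using Jensen_local_to_global[OF assms(1) \<delta>(1)] by blast
  then have "T (x + y) = T x + T y" for x y
    using Jensen_imp_additive assms(5) by blast
  then show ?thesis
    using additive_F_continuous_imp_linear[OF assms(1,2,4)] by blast
qed

end
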